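(* Let $n$ and $k$ be positive integers with $1\leq k\leq \binom{n}{2}$. Then $$f(n,k)=\begin{cases} n+k-2 & \text{if } 1\leq k\leq \binom{n}{2}-2n+4,\\[2pt] \binom{n}{2}+\left\lceil \frac{k-\binom{n}{2}}{2}\right\rceil & \text{if } \binom{n}{2}-2n+5\leq k\leq \binom{n}{2}.\end{cases}$$
   Context: All graphs are finite, simple and undirected. For a connected graph $G$, an edge-coloring of $G$ (adjacent edges may receive the same color) is a monochromatic connection coloring (MC-coloring) if any two vertices of $G$ are joined by a path all of whose edges have the same color. The monochromatic connection number $mc(G)$ is the maximum number of colors used in an MC-coloring of $G$. For positive integers $n,k$ with $1\leq k\leq\binom{n}{2}$, $f(n,k)$ is the minimum integer such that every connected graph $G$ on $n$ vertices with $|E(G)|\geq f(n,k)$ satisfies $mc(G)\geq k$.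
   Formalization: The minimum defining f(n,k) is taken over integers at least n-1, since for k=1 every integer is admissible and no minimum exists; for k≥2 this changes nothing. Graphs have natural numbers as vertices, which covers all finite graphs up to isomorphism. *)

theory Defs
  imports Complex_Main
begin

definition simple_graph :: "'a set \<Rightarrow> 'a set set \<Rightarrow> bool" where
  "simple_graph V E \<longleftrightarrow> finite V \<and> E \<subseteq> {{u, v} | u v. u \<in> V \<and> v \<in> V \<and> u \<noteq> v}"

definition path_edges :: "'a list \<Rightarrow> 'a set set" where
  "path_edges p = {{p ! i, p ! Suc i} | i. Suc i < length p}"

definition path_between :: "'a set \<Rightarrow> 'a set set \<Rightarrow> 'a \<Rightarrow> 'a \<Rightarrow> 'a list \<Rightarrow> bool" where
  "path_between V E u v p \<longleftrightarrow>
     p \<noteq> [] \<and> distinct p \<and> set p \<subseteq> V \<and> path_edges p \<subseteq> E \<and> hd p = u \<and> last p = v"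

definition connected_graph :: "'a set \<Rightarrow> 'a set set \<Rightarrow> bool" where
  "connected_graph V E \<longleftrightarrow>
     simple_graph V E \<and> V \<noteq> {} \<and> (\<forall>u\<in>V. \<forall>v\<in>V. \<exists>p. path_between V E u v p)"

definition mc_coloring :: "'a set \<Rightarrow> 'a set set \<Rightarrow> ('a set \<Rightarrow> nat) \<Rightarrow> bool" where
  "mc_coloring V E c \<longleftrightarrow>
     (\<forall>u\<in>V. \<forall>v\<in>V. \<exists>p. path_between V E u v p \<and> (\<exists>a. \<forall>e\<in>path_edges p. c e = a))"

text \<open>
  For a connected graph the set below is nonempty (constant colorings) and bounded by
  \<open>card E\<close>, so the maximum is attained. Natural numbers provide enough colors
  because the graph is finite.
\<close>

definition mc :: "'a set \<Rightarrow> 'a set set \<Rightarrow> nat" where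
  "mc V E = Max {card (c ` E) | c. mc_coloring V E c}"

text \<open>
  The minimum is taken over the integers from \<open>n - 1\<close> on, the least number of edges of a
  connected graph with \<open>n\<close> vertices. Without this convention there would be no minimum
  integer for \<open>k = 1\<close>, since every connected graph with at least two vertices has
  \<open>mc \<ge> 1\<close>; for \<open>k \<ge> 2\<close> it makes no difference, because trees have \<open>mc \<le> 1\<close>.
  Thresholds above \<open>n choose 2\<close> are vacuously admissible, so the minimum exists. Every
  finite graph is isomorphic to one whose vertices are natural numbers.
\<close>

definition mc_threshold :: "nat \<Rightarrow> nat \<Rightarrow> nat" where
  "mc_threshold n k =
     (LEAST m. n - 1 \<le> m \<and>
        (\<forall>(V :: nat set) E. connected_graph V E \<and> card V = n \<and> m \<le> card E \<longrightarrow> k \<le> mc V E))"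

end

theory Submission
  imports Defs
begin

text \<open>
  Upper bounds: starting from pairwise distinct colors, merging two color classes loses at most one
  color. Merging along a spanning tree loses at most \<open>n - 2\<close> colors; if at most \<open>n - 2\<close> edges
  are missing, then the ends of each missing edge have a common neighbour, and merging the two
  edges to it loses at most one color per missing edge.

  Lower bounds: let \<open>r\<close> be a vertex with \<open>s\<close> non-neighbours. In any MC-coloring, the first edges of
  shortest monochromatic paths from the non-neighbours to \<open>r\<close> are distinct and avoid \<open>r\<close>, and the
  color of each also occurs at \<open>r\<close>. Hence \<open>s\<close> edges can be deleted without losing a color. Graphs
  with a universal vertex and such a vertex \<open>r\<close> match both upper bounds.
\<close>

section \<open>Paths and their edge sets\<close>

lemma path_edges_Nil [simp]: "path_edges [] = {}"
  by (simp add: path_edges_def)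

lemma path_edges_singleton [simp]: "path_edges [x] = {}"
  by (simp add: path_edges_def)

lemma path_edges_Cons_Cons [simp]:
  "path_edges (x # y # p) = insert {x, y} (path_edges (y # p))"
proof (intro equalityI subsetI)
  fix e assume "e \<in> path_edges (x # y # p)"
  then obtain i where i: "e = {(x # y # p) ! i, (x # y # p) ! Suc i}" "Suc i < length (x # y # p)"
    unfolding path_edges_def by blast
  show "e \<in> insert {x, y} (path_edges (y # p))"
  proof (cases i)
    case (Suc j)
    then have "e = {(y # p) ! j, (y # p) ! Suc j}" "Suc j < length (y # p)" using i by auto
    then show ?thesis unfolding path_edges_def by blast
  qed (use i in simp)
next
  fix e assume "e \<in> insert {x, y} (path_edges (y # p))"
  then consider "e = {x, y}"
    | j where "e = {(y # p) ! j, (y # p) ! Suc j}" "Suc j < length (y # p)"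
    unfolding path_edges_def by blast
  then show "e \<in> path_edges (x # y # p)"
  proof cases
    case 1
    then have "e = {(x # y # p) ! 0, (x # y # p) ! Suc 0}" "Suc 0 < length (x # y # p)" by auto
    then show ?thesis unfolding path_edges_def by blast
  next
    case 2
    then have "e = {(x # y # p) ! Suc j, (x # y # p) ! Suc (Suc j)}"
      "Suc (Suc j) < length (x # y # p)" by auto
    then show ?thesis unfolding path_edges_def by blast
  qed
qed

lemma path_edges_append: "path_edges q \<subseteq> path_edges (p @ q)"
proof (induction p)
  case (Cons x p)
  have "path_edges (p @ q) \<subseteq> path_edges (x # p @ q)" by (cases "p @ q") auto
  with Cons show ?case by auto
qed simp

lemma path_edges_last:
  assumes "2 \<le> length p"
  shows "\<exists>e\<in>path_edges p. last p \<in> e"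
proof -
  let ?i = "length p - 2"
  have i: "Suc ?i = length p - 1" using assms by simp
  then have "{p ! ?i, p ! Suc ?i} \<in> path_edges p"
    unfolding path_edges_def using assms by auto
  moreover have "last p = p ! Suc ?i" using assms i by (subst last_conv_nth) auto
  ultimately show ?thesis by (metis insertI1 insert_commute)
qed

lemma path_between_mono_edges:
  assumes "path_between V F u v p" and "path_edges p \<subseteq> E"
  shows "path_between V E u v p"
  using assms by (simp add: path_between_def)

lemma path_between_refl: "v \<in> V \<Longrightarrow> path_between V E v v [v]"
  by (simp add: path_between_def)

text \<open>Turns reachability into a path with distinct vertices, so that connectedness can be
  checked without handling repetitions again.\<close>

lemma path_between_of_rtrancl:
  assumes "(u, v) \<in> {(x, y). x \<in> V \<and> y \<in> V \<and> {x, y} \<in> E}\<^sup>*" and "v \<in> V"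
  shows "\<exists>p. path_between V E u v p"
  using assms(1)
proof (induction rule: converse_rtrancl_induct)
  case base
  show ?case using path_between_refl assms(2) by fast
next
  case (step x y)
  then obtain p where p: "path_between V E y v p" and e: "x \<in> V" "{x, y} \<in> E" by auto
  show ?case
  proof (cases "x \<in> set p")
    case True
    \<comment> \<open>\<open>x\<close> already lies on the path from \<open>y\<close>, so the part
      before \<open>x\<close> is dropped instead of prepending \<open>x\<close>.\<close>
    then obtain as bs where "p = as @ x # bs" by (meson split_list)
    then have "path_between V E x v (x # bs)"
      using p path_edges_append[of "x # bs" as] unfolding path_between_def by auto
    then show ?thesis ..
  next
    case False
    from p obtain q where "p = y # q" unfolding path_between_def by (cases p) auto
    then have "path_between V E x v (x # p)"
      using p e False unfolding path_between_def by auto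
    then show ?thesis ..
  qed
qed

text \<open>Choose for each \<open>x\<close> a shortest path to \<open>r\<close> with property
  \<open>Q\<close>; its second vertex is \<open>y x\<close>. The tail inherits \<open>Q\<close> by
  \<open>down\<close>, so the minimal length \<open>d\<close> drops along \<open>x\<close>,
  \<open>y x\<close>. With \<open>Q\<close> trivial the edges \<open>{x, y x}\<close> form a
  spanning tree; with \<open>Q\<close> saying monochromatic they are the deletable edges of the
  lower bound.\<close>

lemma shortest_path_descent:
  assumes ex: "\<And>x. x \<in> V \<Longrightarrow> \<exists>p. path_between V E x r p \<and> Q (path_edges p)"
    and down: "\<And>F G. F \<subseteq> G \<Longrightarrow> Q G \<Longrightarrow> Q F"
  shows "\<exists>y p (d :: 'a \<Rightarrow> nat). \<forall>x\<in>V - {r}. y x \<in> V \<and> {x, y x} \<in> E \<and> d (y x) < d x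
    \<and> path_between V E x r (p x) \<and> Q (path_edges (p x)) \<and> {x, y x} \<in> path_edges (p x)"
proof -
  define R where "R x p \<longleftrightarrow> path_between V E x r p \<and> Q (path_edges p)" for x p
  define p where "p x = arg_min length (R x)" for x
  define d where "d x = length (p x)" for x
  have Rp: "R x (p x)" if "x \<in> V" for x
    using arg_min_natI[of "R x" _ length] ex[OF that] unfolding p_def R_def by metis
  have dle: "d x \<le> length q" if "R x q" for x q
    unfolding d_def p_def by (rule arg_min_nat_le[of "R x" q length, OF that])
  have "\<exists>z. z \<in> V \<and> {x, z} \<in> E \<and> d z < d x \<and> {x, z} \<in> path_edges (p x)"
    if x: "x \<in> V" "x \<noteq> r" for x
  proof -
    have P: "path_between V E x r (p x)" and Q: "Q (path_edges (p x))"
      using Rp[OF x(1)] unfolding R_def by auto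
    obtain z q where q: "p x = x # z # q"
      using P x(2) unfolding path_between_def
      by (cases "p x" rule: list.exhaust, simp, metis last_ConsL list.exhaust list.sel(1))
    have "Q (path_edges (z # q))" using Q q down[of "path_edges (z # q)" "path_edges (p x)"] by auto
    then have "R z (z # q)" using P q unfolding R_def path_between_def by auto
    from dle[OF this] have "d z < d x" using q unfolding d_def by simp
    then show ?thesis using P q unfolding path_between_def by auto
  qed
  then obtain y where "\<And>x. x \<in> V \<Longrightarrow> x \<noteq> r \<Longrightarrow>
      y x \<in> V \<and> {x, y x} \<in> E \<and> d (y x) < d x \<and> {x, y x} \<in> path_edges (p x)"
    by metis
  then show ?thesis using Rp unfolding R_def by (intro exI[of _ y] exI[of _ p] exI[of _ d]) auto
qed

section \<open>Edges as 2-element sets, and \<open>mc\<close> as an attained maximum\<close>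

lemma simple_graph_iff:
  "simple_graph V E \<longleftrightarrow> finite V \<and> E \<subseteq> {e. e \<subseteq> V \<and> card e = 2}"
proof -
  have "{{u, v} | u v. u \<in> V \<and> v \<in> V \<and> u \<noteq> v} = {e. e \<subseteq> V \<and> card e = 2}"
    by (auto simp: card_2_iff)
  then show ?thesis unfolding simple_graph_def by simp
qed

lemma simple_graph_finite_edges: "simple_graph V E \<Longrightarrow> finite E"
  unfolding simple_graph_iff by (rule finite_subset[of _ "Pow V"]) auto

lemma finite_color_counts:
  assumes "simple_graph V E"
  shows "finite {card (c ` E) | c. mc_coloring V E c}"
  by (rule finite_subset[of _ "{..card E}"])
    (auto intro: card_image_le simple_graph_finite_edges[OF assms])

lemma mc_ge:
  assumes "simple_graph V E" and "mc_coloring V E c" and "k \<le> card (c ` E)"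
  shows "k \<le> mc V E"
proof -
  have "card (c ` E) \<le> mc V E"
    unfolding mc_def by (rule Max_ge[OF finite_color_counts[OF assms(1)]]) (use assms in blast)
  with assms(3) show ?thesis by simp
qed

lemma mc_attained:
  assumes "connected_graph V E"
  shows "\<exists>c. mc_coloring V E c \<and> mc V E = card (c ` E)"
proof -
  have "simple_graph V E" using assms unfolding connected_graph_def by simp
  moreover have "mc_coloring V E (\<lambda>_. 0)"
    using assms unfolding connected_graph_def mc_coloring_def by simp
  ultimately have "mc V E \<in> {card (c ` E) | c. mc_coloring V E c}"
    unfolding mc_def by (intro Max_in finite_color_counts) auto
  then show ?thesis by auto
qed

section \<open>Many edges force many colors: merging color classes\<close>

text \<open>Starting from an injective coloring, each pair recolors one class with the color of
  another. The new coloring is a function of the old one, so equalities already achieved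
  persist.\<close>

lemma coloring_merging_pairs:
  assumes "finite E" and "finite P"
  shows "\<exists>c :: 'a \<Rightarrow> nat. (\<forall>(x, y)\<in>P. c x = c y) \<and> card E \<le> card (c ` E) + card P"
  using assms(2)
proof (induction P)
  case empty
  from assms(1) obtain c :: "'a \<Rightarrow> nat" where "inj_on c E"
    using finite_imp_inj_to_nat_seg by metis
  then show ?case by (intro exI[of _ c]) (simp add: card_image)
next
  case (insert q P)
  obtain x y where q: "q = (x, y)" by (cases q)
  from insert.IH obtain c :: "'a \<Rightarrow> nat"
    where c: "\<forall>(x, y)\<in>P. c x = c y" "card E \<le> card (c ` E) + card P" by blast
  define c' where "c' e = (if c e = c x then c y else c e)" for e
  \<comment> \<open>Only the color \<open>c x\<close> can disappear.\<close>
  have "c ` E - {c x} \<subseteq> c' ` E" by (auto simp: c'_def)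
  then have "card (c ` E - {c x}) \<le> card (c' ` E)" using assms(1) by (simp add: card_mono)
  then have "card (c ` E) \<le> card (c' ` E) + 1"
    using assms(1) card_Diff1_le[of "c ` E" "c x"] by (cases "c x \<in> c ` E") auto
  moreover have "\<forall>(x, y)\<in>insert q P. c' x = c' y" using c(1) q by (auto simp: c'_def)
  ultimately show ?case using c(2) insert.hyps by (intro exI[of _ c']) auto
qed

text \<open>A monochromatic spanning tree joins all pairs of vertices. Its \<open>card V - 1\<close>
  edges get one color by merging all but one of them with that remaining edge.\<close>

lemma mc_ge_spanning_tree:
  assumes con: "connected_graph V E" and n: "2 \<le> card V"
  shows "card E \<le> mc V E + (card V - 2)"
proof -
  have sg: "simple_graph V E" and fV: "finite V"
    using con unfolding connected_graph_def simple_graph_def by auto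
  obtain r x0 where rx: "r \<in> V" "x0 \<in> V" "x0 \<noteq> r"
    using n by (metis card_le_Suc0_iff_eq fV numeral_2_eq_2 not_less_eq_eq)
  have "\<exists>p. path_between V E x r p \<and> True" if "x \<in> V" for x
    using con rx that unfolding connected_graph_def by blast
  then obtain y and d :: "'a \<Rightarrow> nat" where
    y: "\<And>x. x \<in> V \<Longrightarrow> x \<noteq> r \<Longrightarrow> y x \<in> V \<and> {x, y x} \<in> E \<and> d (y x) < d x"
    using shortest_path_descent[of V E r "\<lambda>_. True"] by (metis DiffI singletonD)
  \<comment> \<open>The tree edge at \<open>x0\<close> is the reference edge; leaving out
    \<open>r\<close> and \<open>x0\<close> gives at most \<open>card V - 2\<close> pairs.\<close>
  define P where "P = (\<lambda>x. ({x, y x}, {x0, y x0})) ` (V - {r, x0})"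
  have "card P \<le> card (V - {r, x0})" unfolding P_def by (rule card_image_le) (use fV in simp)
  then have cP: "card P \<le> card V - 2" using rx fV by (simp add: card_Diff_subset)
  have "finite P" unfolding P_def using fV by simp
  then obtain c :: "'a set \<Rightarrow> nat"
    where c: "\<forall>(e, e')\<in>P. c e = c e'" "card E \<le> card (c ` E) + card P"
    using coloring_merging_pairs[OF simple_graph_finite_edges[OF sg]] by blast
  have cT: "c {x, y x} = c {x0, y x0}" if "x \<in> V" "x \<noteq> r" for x
    using that c(1) unfolding P_def by (cases "x = x0") auto
  define T where "T = (\<lambda>x. {x, y x}) ` (V - {r})"
  define A where "A = {(x, z). x \<in> V \<and> z \<in> V \<and> {x, z} \<in> T}"
  have toroot: "x \<in> V \<Longrightarrow> (x, r) \<in> A\<^sup>*" for x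
  proof (induction "d x" arbitrary: x rule: less_induct)
    case less
    show ?case
    proof (cases "x = r")
      case False
      then have "(x, y x) \<in> A" "(y x, r) \<in> A\<^sup>*"
        using less y[of x] unfolding A_def T_def by auto
      then show ?thesis by (rule converse_rtrancl_into_rtrancl)
    qed simp
  qed
  have "sym A" unfolding A_def sym_def by (auto simp: insert_commute)
  then have symA: "sym (A\<^sup>*)" by (rule sym_rtrancl)
  have "mc_coloring V E c"
    unfolding mc_coloring_def
  proof (intro ballI)
    fix u v assume uv: "u \<in> V" "v \<in> V"
    have "(u, v) \<in> A\<^sup>*" using toroot[OF uv(1)] symD[OF symA toroot[OF uv(2)]] by simp
    then obtain p where p: "path_between V T u v p"
      using path_between_of_rtrancl[of u v V T] uv unfolding A_def by blast
    then have sub: "path_edges p \<subseteq> T" unfolding path_between_def by simp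
    have "T \<subseteq> E" using y unfolding T_def by auto
    then have "path_between V E u v p" using p sub by (blast intro: path_between_mono_edges)
    moreover have "\<forall>e\<in>path_edges p. c e = c {x0, y x0}" using sub cT unfolding T_def by auto
    ultimately show "\<exists>p. path_between V E u v p \<and> (\<exists>a. \<forall>e\<in>path_edges p. c e = a)" by blast
  qed
  from mc_ge[OF sg this order_refl] c(2) cP show ?thesis by linarith
qed

text \<open>Otherwise each further vertex \<open>w\<close> misses an edge to \<open>u\<close> or to
  \<open>v\<close>. These \<open>card V - 2\<close> missing edges are distinct and differ from
  \<open>{u, v}\<close>, which makes one missing edge too many.\<close>

lemma common_neighbour:
  assumes sg: "simple_graph V E" and uv: "u \<in> V" "v \<in> V" "u \<noteq> v" "{u, v} \<notin> E"
    and few: "card ({e. e \<subseteq> V \<and> card e = 2} - E) \<le> card V - 2"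
  shows "\<exists>w\<in>V. w \<noteq> u \<and> w \<noteq> v \<and> {u, w} \<in> E \<and> {w, v} \<in> E"
proof (rule ccontr)
  assume no: "\<not> ?thesis"
  have fV: "finite V" using sg unfolding simple_graph_def by simp
  let ?M = "{e. e \<subseteq> V \<and> card e = 2} - E"
  define g where "g w = (if {u, w} \<in> E then {w, v} else {u, w})" for w
  have fin: "finite ?M" by (rule finite_subset[of _ "Pow V"]) (use fV in auto)
  have inj: "inj_on g (V - {u, v})" by (auto simp: inj_on_def g_def doubleton_eq_iff split: if_splits)
  have sub: "g ` (V - {u, v}) \<subseteq> ?M - {{u, v}}"
    using no uv unfolding g_def by (auto simp: doubleton_eq_iff card_insert_if)
  have "card (V - {u, v}) \<le> card (?M - {{u, v}})"
    using card_inj_on_le[OF inj sub] fin by simp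
  also have "\<dots> < card ?M" by (rule card_Diff1_less[OF fin]) (use uv in auto)
  finally have "card V - 2 < card ?M" using uv fV by (simp add: card_Diff_subset)
  then show False using few by simp
qed

lemma mc_ge_missing_edges:
  assumes con: "connected_graph V E"
    and few: "card ({e. e \<subseteq> V \<and> card e = 2} - E) \<le> card V - 2"
  shows "card E \<le> mc V E + card ({e. e \<subseteq> V \<and> card e = 2} - E)"
proof -
  have sg: "simple_graph V E" and fV: "finite V"
    using con unfolding connected_graph_def simple_graph_def by auto
  let ?M = "{e. e \<subseteq> V \<and> card e = 2} - E"
  have finM: "finite ?M" by (rule finite_subset[of _ "Pow V"]) (use fV in auto)
  \<comment> \<open>\<open>q\<close> is the pair of edges of a two-edge path joining the ends of the
    missing edge \<open>e\<close>.\<close>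
  define detour where "detour e q \<longleftrightarrow> (\<exists>u v w. e = {u, v} \<and> u \<noteq> v \<and> w \<in> V \<and> w \<noteq> u \<and> w \<noteq> v
    \<and> {u, w} \<in> E \<and> {w, v} \<in> E \<and> q = ({u, w}, {w, v}))" for e q
  have "\<exists>q. detour e q" if "e \<in> ?M" for e
  proof -
    from that obtain u v where uv: "e = {u, v}" "u \<noteq> v" by (auto simp: card_2_iff)
    with that have "u \<in> V" "v \<in> V" "{u, v} \<notin> E" by auto
    with uv obtain w where "w \<in> V" "w \<noteq> u" "w \<noteq> v" "{u, w} \<in> E" "{w, v} \<in> E"
      using common_neighbour[OF sg _ _ _ _ few, of u v] by blast
    with uv have "detour e ({u, w}, {w, v})" unfolding detour_def by blast
    then show ?thesis ..
  qed
  then obtain q where q: "\<forall>e\<in>?M. detour e (q e)" using bchoice[of ?M detour] by blast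
  define P where "P = q ` ?M"
  have cP: "card P \<le> card ?M" unfolding P_def by (rule card_image_le[OF finM])
  have "finite P" unfolding P_def using finM by simp
  then obtain c :: "'a set \<Rightarrow> nat"
    where c: "\<forall>(e, e')\<in>P. c e = c e'" "card E \<le> card (c ` E) + card P"
    using coloring_merging_pairs[OF simple_graph_finite_edges[OF sg]] by blast
  have "mc_coloring V E c"
    unfolding mc_coloring_def
  proof (intro ballI)
    fix u v assume uv: "u \<in> V" "v \<in> V"
    consider "u = v" | "u \<noteq> v" "{u, v} \<in> E" | "{u, v} \<in> ?M"
      using uv by (cases "u = v") auto
    then show "\<exists>p. path_between V E u v p \<and> (\<exists>a. \<forall>e\<in>path_edges p. c e = a)"
    proof cases
      case 1
      then show ?thesis using uv by (intro exI[of _ "[u]"]) (auto simp: path_between_refl)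
    next
      case 2
      then show ?thesis using uv by (intro exI[of _ "[u, v]"]) (auto simp: path_between_def)
    next
      case 3
      with q have "detour {u, v} (q {u, v})" by (rule bspec)
      then obtain u' v' w where w: "{u, v} = {u', v'}" "u' \<noteq> v'" "w \<in> V" "w \<noteq> u'" "w \<noteq> v'"
        "{u', w} \<in> E" "{w, v'} \<in> E" "q {u, v} = ({u', w}, {w, v'})"
        unfolding detour_def by (elim exE conjE) (rule that)
      have "q {u, v} \<in> P" using 3 unfolding P_def by blast
      then have "c {u', w} = c {w, v'}" using c(1) w(8) by auto
      \<comment> \<open>The ends \<open>u'\<close>, \<open>v'\<close> stored with the unordered pair
        may be \<open>u\<close>, \<open>v\<close> in either order; the detour is symmetric.\<close>
      with w have "w \<noteq> u" "w \<noteq> v" "u \<noteq> v" "{u, w} \<in> E" "{w, v} \<in> E" "c {u, w} = c {w, v}"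
        by (metis doubleton_eq_iff insert_commute)+
      then show ?thesis using uv w(3) by (intro exI[of _ "[u, w, v]"]) (auto simp: path_between_def)
    qed
  qed
  from mc_ge[OF sg this order_refl] c(2) cP show ?thesis by linarith
qed

section \<open>Non-neighbours of a vertex cost colors\<close>

text \<open>Each \<open>x\<close> in \<open>S\<close> yields one edge that can be deleted: its color
  recurs on the edge at \<open>r\<close> of the same monochromatic path, and no deleted edge
  contains \<open>r\<close>.\<close>

lemma mc_le_non_neighbours:
  assumes con: "connected_graph V E" and r: "r \<in> V"
    and S: "S \<subseteq> V - {r}" "\<And>x. x \<in> S \<Longrightarrow> {x, r} \<notin> E"
  shows "mc V E + card S \<le> card E"
proof -
  have sg: "simple_graph V E" using con unfolding connected_graph_def by simp
  then have finE: "finite E" by (rule simple_graph_finite_edges)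
  obtain c where c: "mc_coloring V E c" and mc: "mc V E = card (c ` E)"
    using mc_attained[OF con] by blast
  define Q where "Q F \<longleftrightarrow> (\<exists>a. \<forall>e\<in>F. c e = a)" for F
  have ex: "\<exists>p. path_between V E x r p \<and> Q (path_edges p)" if "x \<in> V" for x
    using that c r unfolding mc_coloring_def Q_def by blast
  have down: "Q F" if "F \<subseteq> G" "Q G" for F G using that unfolding Q_def by blast
  have "\<exists>y p (d :: 'a \<Rightarrow> nat). \<forall>x\<in>V - {r}. y x \<in> V \<and> {x, y x} \<in> E \<and> d (y x) < d x
      \<and> path_between V E x r (p x) \<and> Q (path_edges (p x)) \<and> {x, y x} \<in> path_edges (p x)"
    by (rule shortest_path_descent) (fact ex, fact down)
  then obtain y p and d :: "'a \<Rightarrow> nat"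
    where y: "\<forall>x\<in>V - {r}. y x \<in> V \<and> {x, y x} \<in> E \<and> d (y x) < d x
      \<and> path_between V E x r (p x) \<and> Q (path_edges (p x)) \<and> {x, y x} \<in> path_edges (p x)"
    by (elim exE) (rule that)
  define T where "T = (\<lambda>x. {x, y x}) ` S"
  have yS: "y x \<in> V" "{x, y x} \<in> E" "d (y x) < d x" "path_between V E x r (p x)"
    "Q (path_edges (p x))" "{x, y x} \<in> path_edges (p x)" "x \<noteq> r" if "x \<in> S" for x
    using y S(1) that by blast+
  have TE: "T \<subseteq> E" using yS unfolding T_def by blast
  \<comment> \<open>If two vertices chose the same edge, each would be the successor of the other,
    and \<open>d\<close> would decrease in both directions.\<close>
  have "inj_on (\<lambda>x. {x, y x}) S"
  proof (rule inj_onI)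
    fix x z assume xz: "x \<in> S" "z \<in> S" "{x, y x} = {z, y z}"
    then have "x = z \<or> (z = y x \<and> x = y z)" by (auto simp: doubleton_eq_iff)
    then show "x = z" using yS(3)[OF xz(1)] yS(3)[OF xz(2)] by auto
  qed
  then have cT: "card T = card S" unfolding T_def by (rule card_image)
  have "c e \<in> c ` (E - T)" if "e \<in> T" for e
  proof -
    from that obtain x where x: "x \<in> S" "e = {x, y x}" unfolding T_def by blast
    have "2 \<le> length (p x)"
    proof (rule ccontr)
      assume "\<not> ?thesis"
      then have "path_edges (p x) = {}" by (auto simp: path_edges_def)
      with yS(6)[OF x(1)] show False by simp
    qed
    then obtain e' where e': "e' \<in> path_edges (p x)" "r \<in> e'"
      using path_edges_last[of "p x"] yS(4)[OF x(1)] unfolding path_between_def by auto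
    have "e' \<in> E" using e'(1) yS(4)[OF x(1)] unfolding path_between_def by auto
    \<comment> \<open>An edge of \<open>T\<close> at \<open>r\<close> would join \<open>r\<close> to
      a vertex of \<open>S\<close>.\<close>
    moreover have "e' \<notin> T"
    proof
      assume "e' \<in> T"
      then obtain z where z: "z \<in> S" "e' = {z, y z}" unfolding T_def by blast
      then have "y z = r" using e'(2) yS(7)[OF z(1)] by auto
      then show False using yS(2)[OF z(1)] S(2)[OF z(1)] by simp
    qed
    moreover have "c e = c e'" using yS(5,6)[OF x(1)] e'(1) x(2) unfolding Q_def by auto
    ultimately show ?thesis by auto
  qed
  then have "c ` E \<subseteq> c ` (E - T)" by auto
  then have "card (c ` E) \<le> card (c ` (E - T))" by (intro card_mono) (use finE in auto)
  also have "\<dots> \<le> card (E - T)" by (rule card_image_le) (use finE in simp)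
  also have "\<dots> = card E - card S"
    using TE finE cT by (metis card_Diff_subset finite_subset)
  finally show ?thesis using mc cT card_mono[OF finE TE] by linarith
qed

text \<open>Vertex \<open>1\<close> is universal, which gives connectedness, and vertex
  \<open>0\<close> is not adjacent to \<open>2\<close>, ..., \<open>s + 1\<close>. Any
  \<open>m\<close> edges that contain the star at \<open>1\<close> and avoid these \<open>s\<close>
  pairs will do.\<close>

lemma exists_graph_mc_le:
  assumes n: "2 \<le> n" and s: "s \<le> n - 2" and m: "n - 1 \<le> m" "m + s \<le> n choose 2"
  shows "\<exists>(V :: nat set) E. connected_graph V E \<and> card V = n \<and> card E = m \<and> mc V E + s \<le> m"
proof -
  define V where "V = {..<n}"
  define A where "A = {e. e \<subseteq> V \<and> card e = 2}"
  define F where "F = (\<lambda>x. {x, 0 :: nat}) ` {2..<s + 2}"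
  define star where "star = (\<lambda>x. {x, 1 :: nat}) ` (V - {1})"
  have finA: "finite A" unfolding A_def V_def by (rule finite_subset[of _ "Pow {..<n}"]) auto
  have cA: "card A = n choose 2" unfolding A_def using n_subsets[of V 2] by (simp add: V_def)
  have "inj_on (\<lambda>x. {x, 0 :: nat}) {2..<s + 2}" by (auto simp: inj_on_def doubleton_eq_iff)
  then have cF: "card F = s" unfolding F_def by (simp add: card_image)
  have "F \<subseteq> A" unfolding F_def A_def V_def using s n by auto
  then have cAF: "card (A - F) = (n choose 2) - s"
    using cA cF finA by (metis card_Diff_subset finite_subset)
  have "inj_on (\<lambda>x. {x, 1 :: nat}) (V - {1})" by (auto simp: inj_on_def doubleton_eq_iff)
  then have cS: "card star = n - 1" unfolding star_def using n by (simp add: card_image V_def)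
  have "star \<subseteq> A - F" unfolding star_def F_def A_def V_def using n by (auto simp: doubleton_eq_iff)
  moreover have "card star \<le> m" "m \<le> card (A - F)" using cS cAF m by auto
  ultimately obtain E where E: "star \<subseteq> E" "E \<subseteq> A - F" "card E = m"
    using exists_subset_between[of star m "A - F"] finA by auto
  have sg: "simple_graph V E" unfolding simple_graph_iff using E(2) by (auto simp: A_def V_def)
  have one: "1 \<in> V" using n by (simp add: V_def)
  have edge: "{x, 1} \<in> E" "{1, x} \<in> E" if "x \<in> V" "x \<noteq> 1" for x
    using that E(1) unfolding star_def by (auto simp: insert_commute)
  have "\<exists>p. path_between V E u v p" if uv: "u \<in> V" "v \<in> V" for u v
  proof (rule path_between_of_rtrancl)
    let ?R = "{(x, y). x \<in> V \<and> y \<in> V \<and> {x, y} \<in> E}"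
    have "(u, 1) \<in> ?R\<^sup>*" using edge uv one by (cases "u = 1") auto
    moreover have "(1, v) \<in> ?R\<^sup>*" using edge uv one by (cases "v = 1") auto
    ultimately show "(u, v) \<in> ?R\<^sup>*" by simp
  qed fact
  then have con: "connected_graph V E" unfolding connected_graph_def using sg one by blast
  have "mc V E + card {2..<s + 2} \<le> card E"
  proof (rule mc_le_non_neighbours[OF con])
    show "0 \<in> V" "{2..<s + 2} \<subseteq> V - {0}" using n s by (auto simp: V_def)
    show "{x, 0} \<notin> E" if "x \<in> {2..<s + 2}" for x
      using that E(2) unfolding F_def by blast
  qed
  then show ?thesis using con E(3) by (intro exI[of _ V] exI[of _ E]) (simp add: V_def)
qed

section \<open>Computing the threshold\<close>

text \<open>Reduces minimality to arithmetic: for each \<open>m\<close> below \<open>f\<close>, a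
  number \<open>s\<close> of non-neighbours with \<open>m - s < k\<close> gives a graph with
  \<open>m\<close> edges and too few colors.\<close>

lemma mc_threshold_eqI:
  assumes n: "2 \<le> n" and f: "n - 1 \<le> f"
    and upper: "\<And>(V :: nat set) E. connected_graph V E \<Longrightarrow> card V = n \<Longrightarrow> f \<le> card E
      \<Longrightarrow> k \<le> mc V E"
    and lower: "\<And>m. n - 1 \<le> m \<Longrightarrow> m < f \<Longrightarrow> \<exists>s. s \<le> n - 2 \<and> m + s \<le> n choose 2 \<and> m < k + s"
  shows "mc_threshold n k = f"
  unfolding mc_threshold_def
proof (rule Least_equality)
  show "n - 1 \<le> f \<and> (\<forall>(V :: nat set) E. connected_graph V E \<and> card V = n \<and> f \<le> card E \<longrightarrow> k \<le> mc V E)"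
    using f upper by blast
next
  fix m
  assume m: "n - 1 \<le> m \<and> (\<forall>(V :: nat set) E. connected_graph V E \<and> card V = n \<and> m \<le> card E \<longrightarrow> k \<le> mc V E)"
  show "f \<le> m"
  proof (rule ccontr)
    assume "\<not> f \<le> m"
    then obtain s where s: "s \<le> n - 2" "m + s \<le> n choose 2" "m < k + s"
      using lower[of m] m by auto
    then obtain V :: "nat set" and E where "connected_graph V E" "card V = n" "card E = m" "mc V E + s \<le> m"
      using exists_graph_mc_le[OF n s(1) _ s(2)] m by blast
    with m s(3) show False by fastforce
  qed
qed

theorem theorem3:
  fixes n k :: nat
  assumes "1 \<le> n" and "1 \<le> k" and "k \<le> n choose 2"
  shows "int (mc_threshold n k) =
    (if int k \<le> int (n choose 2) - 2 * int n + 4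
     then int n + int k - 2
     else int (n choose 2) + \<lceil>(real k - real (n choose 2)) / 2\<rceil>)"
proof -
  define C where "C = n choose 2"
  have n: "2 \<le> n"
  proof (rule ccontr)
    assume "\<not> 2 \<le> n"
    then have "n choose 2 = 0" by simp
    with assms show False by simp
  qed
  show ?thesis
  proof (cases "int k \<le> int C - 2 * int n + 4")
    case True
    then have kC: "k + 2 * n \<le> C + 4" by linarith
    have "mc_threshold n k = n + k - 2"
    proof (rule mc_threshold_eqI[OF n])
      show "n - 1 \<le> n + k - 2" using n assms by linarith
      show "k \<le> mc V E" if "connected_graph V E" "card V = n" "n + k - 2 \<le> card E" for V :: "nat set" and E
        using mc_ge_spanning_tree[OF that(1)] that n by linarith
      show "\<exists>s. s \<le> n - 2 \<and> m + s \<le> n choose 2 \<and> m < k + s" if "n - 1 \<le> m" "m < n + k - 2" for m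
        \<comment> \<open>The largest possible \<open>s\<close> fits, since
          \<open>m + (n - 2)\<close> is at most \<open>k + 2 * n - 5\<close>, which is below
          \<open>C\<close>.\<close>
        using that n kC unfolding C_def by (intro exI[of _ "n - 2"]) auto
    qed
    then show ?thesis using True n assms unfolding C_def by auto
  next
    case False
    then have kC: "C + 5 \<le> k + 2 * n" by linarith
    have kC': "k \<le> C" using assms unfolding C_def by simp
    \<comment> \<open>The number of edges that may be missing: \<open>C - t\<close> edges remain and
      merging costs at most \<open>t\<close> colors, so \<open>C - 2 * t\<close> colors must reach
      \<open>k\<close>. The ceiling in the statement is \<open>- t\<close>.\<close>
    define t where "t = (C - k) div 2"
    have t: "2 * t \<le> C - k" "C - k \<le> 2 * t + 1" unfolding t_def by linarith+
    \<comment> \<open>Here \<open>C - k\<close> is at most \<open>2 * n - 5\<close>, hence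
      \<open>t\<close> is at most \<open>n - 3\<close>; this meets the bound on missing edges in
      \<open>mc_ge_missing_edges\<close>.\<close>
    have tn: "t + 3 \<le> n" using t kC kC' n by presburger
    have tC: "t \<le> C" using t by linarith
    have "real C - real k = real (C - k)" using kC' by simp
    then have "2 * real t \<le> real C - real k" "real C - real k \<le> 2 * real t + 1"
      using t by linarith+
    then have ceil: "\<lceil>(real k - real C) / 2\<rceil> = - int t"
      by (intro ceiling_unique) auto
    have "mc_threshold n k = C - t"
    proof (rule mc_threshold_eqI[OF n])
      \<comment> \<open>Twice the difference of the two sides is \<open>j * j + j\<close> for
        \<open>n = j + 3\<close>.\<close>
      have "n - 1 + (n - 2) \<le> C"
      proof -
        obtain j where j: "n = j + 3" using tn by (metis add.commute le_Suc_ex add_leD2)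
        have "2 * C = n * (n - 1)" unfolding C_def choose_two by (intro dvd_mult_div_cancel) auto
        also have "\<dots> = 2 * (n - 1 + (n - 2)) + (j * j + j)" using j by (simp add: algebra_simps)
        finally have "2 * (n - 1 + (n - 2)) \<le> 2 * C" by (metis le_add1)
        then show ?thesis by simp
      qed
      then show "n - 1 \<le> C - t" using tn by linarith
      show "k \<le> mc V E" if G: "connected_graph V E" "card V = n" "C - t \<le> card E" for V :: "nat set" and E
      proof -
        have sg: "simple_graph V E" using G unfolding connected_graph_def by simp
        then have "finite V" by (simp add: simple_graph_def)
        then have "card {e. e \<subseteq> V \<and> card e = 2} = C" using n_subsets[of V 2] G unfolding C_def by simp
        moreover have "E \<subseteq> {e. e \<subseteq> V \<and> card e = 2}" using sg by (simp add: simple_graph_iff)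
        ultimately have "card ({e. e \<subseteq> V \<and> card e = 2} - E) = C - card E"
          using simple_graph_finite_edges[OF sg] by (simp add: card_Diff_subset)
        then show ?thesis using mc_ge_missing_edges[OF G(1)] G tn t tC kC' by linarith
      qed
      show "\<exists>s. s \<le> n - 2 \<and> m + s \<le> n choose 2 \<and> m < k + s" if "n - 1 \<le> m" "m < C - t" for m
      \<comment> \<open>The witness is the minimum of \<open>n - 2\<close> and \<open>C - m\<close>:
        vertex \<open>0\<close> loses as many edges as the universal vertex and the number of
        missing edges allow. In the second case \<open>2 * m < C + k\<close> follows from
        \<open>m < C - t\<close>.\<close>
      proof (cases "n - 2 \<le> C - m")
        case True
        then show ?thesis using that tn t kC'
          unfolding C_def[symmetric] by (intro exI[of _ "n - 2"] conjI) linarith+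
      next
        case False
        then show ?thesis using that t kC'
          unfolding C_def[symmetric] by (intro exI[of _ "C - m"] conjI) linarith+
      qed
    qed
    then show ?thesis using False ceil tC unfolding C_def by auto
  qed
qed

end
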